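(* For every positive real number $N$, $$\sum_{k=1}^{\pi(\sqrt{N})}\pi\!\left(\frac{N}{p_k}\right)-\sum_{k=\pi(\sqrt{N})+1}^{\pi(N/2)}\pi\!\left(\frac{N}{p_k}\right)=\left(\pi(\sqrt{N})\right)^2.$$
   Context: $\pi(x)$ denotes the prime counting function, i.e. the number of primes $p\le x$. $p_k$ denotes the $k$-th prime ($p_1=2,p_2=3,\dots$). An empty sum (in particular when the lower summation index exceeds the upper one) equals $0$. *)

theory Defs
  imports Complex_Main "HOL-Computational_Algebra.Primes" "HOL-Library.Infinite_Set"
begin

definition prime_pi :: "real \<Rightarrow> nat" where
  "prime_pi x = card {p :: nat. prime p \<and> real p \<le> x}"

(* enumerate counts from 0, whereas the k-th prime is indexed from k = 1;
   the value at 0 (which is 2, by truncated subtraction) is meaningless. *)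
definition nth_prime :: "nat \<Rightarrow> nat" where
  "nth_prime k = enumerate {p :: nat. prime p} (k - 1)"

end

theory Submission
  imports Defs
begin

text \<open>
  Both sums count pairs of primes \<open>(p, q)\<close> with \<open>p * q \<le> N\<close>: the first those with
  \<open>p \<le> sqrt N\<close>, the second those with \<open>p > sqrt N\<close> (the condition \<open>p \<le> N / 2\<close> is implied by
  \<open>q \<ge> 2\<close>). In the second case \<open>q \<le> sqrt N\<close>, so swapping the entries
  maps these pairs into the first set, and what remains of it is the full square
  \<open>p, q \<le> sqrt N\<close>.
\<close>

definition primes_upto :: "real \<Rightarrow> nat set" where
  "primes_upto x = {p. prime p \<and> real p \<le> x}"

lemma finite_primes_upto [simp]: "finite (primes_upto x)"
proof (rule finite_subset)
  show "primes_upto x \<subseteq> {..nat \<lfloor>x\<rfloor>}"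
    by (auto simp: primes_upto_def le_nat_floor)
qed simp

lemma prime_pi_eq_card: "prime_pi x = card (primes_upto x)"
  by (simp add: prime_pi_def primes_upto_def)

lemma finite_down_closed_eq_lessThan:
  fixes A :: "nat set"
  assumes "finite A" and "\<And>m n. n \<in> A \<Longrightarrow> m \<le> n \<Longrightarrow> m \<in> A"
  shows "A = {..<card A}"
proof (cases "A = {}")
  case False
  have "A = {..Max A}"
    using assms False Max_in by auto
  then show ?thesis
    by (metis card_atMost lessThan_Suc_atMost)
qed simp

text \<open>Since the enumeration is increasing and injective, the indices j counted from 0 whose
  prime is at most x form a finite initial segment of the naturals with \<open>prime_pi x\<close>
  elements. The index shift turns \<open>k - 1 < prime_pi x\<close> into
  \<open>k \<le> prime_pi x\<close>; this needs \<open>k \<ge> 1\<close>.\<close>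

lemma nth_prime_le_iff:
  assumes "k \<ge> 1"
  shows "real (nth_prime k) \<le> x \<longleftrightarrow> k \<le> prime_pi x"
proof -
  let ?e = "enumerate {p :: nat. prime p}"
  let ?A = "{j. real (?e j) \<le> x}"
  have bij: "bij_betw ?e UNIV {p. prime p}"
    by (rule bij_enumerate[OF primes_infinite])
  then have inj: "inj ?e" and ran: "range ?e = {p. prime p}"
    by (auto simp: bij_betw_def)
  have img: "?e ` ?A = primes_upto x"
  proof -
    have "primes_upto x = {p \<in> range ?e. real p \<le> x}"
      by (simp only: ran primes_upto_def mem_Collect_eq)
    also have "\<dots> = ?e ` ?A"
      by blast
    finally show ?thesis ..
  qed
  have fin: "finite ?A"
    using img inj by (metis finite_imageD finite_primes_upto inj_on_subset subset_UNIV)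
  have card: "card ?A = prime_pi x"
    using img inj by (metis card_image inj_on_subset prime_pi_eq_card subset_UNIV)
  have mono: "?e m \<le> ?e n" if "m \<le> n" for m n
    using that primes_infinite by (simp add: enumerate_mono_le_iff)
  have "?A = {..<card ?A}"
  proof (rule finite_down_closed_eq_lessThan[OF fin])
    fix m n assume "n \<in> ?A" "m \<le> n"
    then show "m \<in> ?A"
      using mono[of m n] by simp
  qed
  then have "?A = {..<prime_pi x}"
    by (simp only: card)
  then have "k - 1 \<in> ?A \<longleftrightarrow> k - 1 < prime_pi x"
    by blast
  then show ?thesis
    using assms by (auto simp: nth_prime_def)
qed

text \<open>The domain starts at 1 because truncated subtraction makes \<open>nth_prime 0\<close>
  and \<open>nth_prime 1\<close> coincide.\<close>

lemma bij_betw_nth_prime: "bij_betw nth_prime {1..} {p. prime p}"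
proof -
  have "bij_betw (\<lambda>k. k - 1) {1..} (UNIV :: nat set)"
    by (rule bij_betw_byWitness[where f' = Suc]) auto
  from bij_betw_trans[OF this bij_enumerate[OF primes_infinite]]
  show ?thesis
    by (simp add: nth_prime_def[abs_def] comp_def)
qed

text \<open>Reindexes both sums of the theorem by primes instead of indices. For
  \<open>y < x\<close> both sides are empty, which covers the empty second sum when
  \<open>N / 2 < sqrt N\<close>.\<close>

lemma bij_betw_nth_prime_interval:
  "bij_betw nth_prime {prime_pi x + 1..prime_pi y} (primes_upto y - primes_upto x)"
proof (rule bij_betw_subset[OF bij_betw_nth_prime])
  have mem: "nth_prime k \<in> primes_upto z \<longleftrightarrow> k \<le> prime_pi z" if "k \<ge> 1" for k z
    using that bij_betw_nth_prime nth_prime_le_iff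
    by (auto simp: primes_upto_def bij_betw_def)
  show "nth_prime ` {prime_pi x + 1..prime_pi y} = primes_upto y - primes_upto x" (is "?L = ?R")
  proof
    show "?L \<subseteq> ?R"
      by (auto simp: mem)
    show "?R \<subseteq> ?L"
    proof
      fix p assume p: "p \<in> ?R"
      then have "p \<in> nth_prime ` {1..}"
        using bij_betw_nth_prime by (auto simp: bij_betw_def primes_upto_def)
      then obtain k where "k \<ge> 1" "p = nth_prime k"
        by auto
      then show "p \<in> ?L"
        using p by (auto simp: mem)
    qed
  qed
qed auto

lemma primes_upto_0 [simp]: "primes_upto 0 = {}"
  by (auto simp: primes_upto_def)

lemma prime_pi_0 [simp]: "prime_pi 0 = 0"
  by (simp add: prime_pi_eq_card)

text \<open>The sum counts pairs fibre by fibre over p; positivity of p turns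
  \<open>q \<le> N / p\<close> into \<open>p * q \<le> N\<close>.\<close>

lemma sum_prime_pi_eq_card:
  assumes "\<And>p. p \<in> A \<Longrightarrow> p > 0" and "finite A"
  shows "(\<Sum>p\<in>A. prime_pi (N / real p))
       = card {(p, q). p \<in> A \<and> prime q \<and> real p * real q \<le> N}"
proof -
  have "(\<Sum>p\<in>A. prime_pi (N / real p)) = card (SIGMA p:A. primes_upto (N / real p))"
    using assms(2) by (simp add: prime_pi_eq_card)
  also have "(SIGMA p:A. primes_upto (N / real p))
           = {(p, q). p \<in> A \<and> prime q \<and> real p * real q \<le> N}"
    using assms(1) by (auto simp: primes_upto_def field_simps)
  finally show ?thesis .
qed

theorem theorem2:
  fixes N :: real
  assumes "N > 0"
  shows "(\<Sum>k = 1..prime_pi (sqrt N). int (prime_pi (N / real (nth_prime k))))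
       - (\<Sum>k = prime_pi (sqrt N) + 1..prime_pi (N / 2). int (prime_pi (N / real (nth_prime k))))
       = (int (prime_pi (sqrt N)))\<^sup>2"
proof -
  let ?f = "\<lambda>p. prime_pi (N / real p)"
  let ?S = "primes_upto (sqrt N)"
  let ?T = "primes_upto (N / 2) - ?S"
  let ?A = "{(p, q). p \<in> ?S \<and> prime q \<and> real p * real q \<le> N}"
  let ?B = "{(p, q). p \<in> ?T \<and> prime q \<and> real p * real q \<le> N}"
  have pos: "p > 0" if "p \<in> primes_upto x" for p x
    using that by (simp add: primes_upto_def prime_gt_0_nat)
  \<comment> \<open>Taking 0 as the lower bound makes the index range start at 1 and removes no
    primes.\<close>
  have sum_S: "(\<Sum>k = 1..prime_pi (sqrt N). ?f (nth_prime k)) = card ?A"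
    using sum.reindex_bij_betw[OF bij_betw_nth_prime_interval[of 0 "sqrt N"], of ?f]
      sum_prime_pi_eq_card[of ?S N] pos by simp
  have sum_T: "(\<Sum>k = prime_pi (sqrt N) + 1..prime_pi (N / 2). ?f (nth_prime k)) = card ?B"
    by (rule trans[OF sum.reindex_bij_betw[OF bij_betw_nth_prime_interval]
          sum_prime_pi_eq_card]) (auto dest: pos)
  have sq: "sqrt N * sqrt N = N"
    using assms by simp
  have small: "real p * real q \<le> N" if "real p \<le> sqrt N" "real q \<le> sqrt N" for p q :: nat
    using mult_mono[OF that] assms sq by simp
  have large: "real p \<le> sqrt N" if "real p * real q \<le> N" "\<not> real q \<le> sqrt N" for p q :: nat
  proof (rule ccontr)
    assume "\<not> real p \<le> sqrt N"
    then have "sqrt N * sqrt N < real p * real q"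
      using that assms by (intro mult_strict_mono') auto
    then show False
      using that sq by simp
  qed
  have half: "real p \<le> N / 2" if "real p * real q \<le> N" "prime q" for p q :: nat
  proof -
    have "real p * 2 \<le> real p * real q"
      using prime_ge_2_nat[OF that(2)] by (intro mult_left_mono) auto
    then show ?thesis
      using that by simp
  qed
  have split: "?A = ?S \<times> ?S \<union> prod.swap ` ?B"
  proof (rule set_eqI)
    fix z :: "nat \<times> nat"
    obtain p q where z: "z = (p, q)"
      by fastforce
    have "z \<in> prod.swap ` ?B \<longleftrightarrow> (q, p) \<in> ?B"
      by (force simp: z)
    \<comment> \<open>The bound \<open>q \<le> N / 2\<close> required by \<open>?T\<close> comes
      from \<open>half\<close>, and \<open>p \<le> sqrt N\<close> required by \<open>?A\<close> from
      \<open>large\<close>.\<close>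
    also have "\<dots> \<longleftrightarrow> (p, q) \<in> ?A \<and> q \<notin> ?S"
      using half[of q p] large[of p q] by (auto simp: primes_upto_def mult.commute)
    finally show "z \<in> ?A \<longleftrightarrow> z \<in> ?S \<times> ?S \<union> prod.swap ` ?B"
      using small[of p q] by (auto simp: z primes_upto_def)
  qed
  have "card (prod.swap ` ?B) = card ?B"
    by (rule card_image) simp
  \<comment> \<open>The definition of \<open>?B\<close> does not bound the second entry explicitly;
    \<open>large\<close> confines it to \<open>?S\<close>.\<close>
  moreover have "finite (prod.swap ` ?B)"
  proof (rule finite_subset)
    show "prod.swap ` ?B \<subseteq> ?S \<times> primes_upto (N / 2)"
      using large by (auto simp: primes_upto_def mult.commute)
  qed simp
  \<comment> \<open>After swapping, the second entry lies in \<open>?T\<close>, hence outside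
    \<open>?S\<close>.\<close>
  moreover have "?S \<times> ?S \<inter> prod.swap ` ?B = {}"
    by auto
  ultimately have "card ?A = (prime_pi (sqrt N))\<^sup>2 + card ?B"
    unfolding split
    by (subst card_Un_disjoint) (auto simp: prime_pi_eq_card power2_eq_square card_cartesian_product)
  then show ?thesis
    by (simp only: sum_S sum_T flip: of_nat_sum) simp
qed

end
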